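(* There exist an absolute constant $C_8>0$ and constants $C_{10}(\ell)>0$, $C_{11}(\ell)>0$ for each integer $\ell\ge1$ (depending only on $\ell$) such that, with $C_9:=16\pi e$, the following holds. For any $\mathcal{X}=\{x_1,\dots,x_s\}\subset\mathbb{R}$ forming a $(\Delta,\theta,s,\ell,\tau)_{\mathbb{R}}$-clustered configuration with $\theta\ge C_{10}(\ell)\,s$ and $s\tau\Delta\le C_{11}(\ell)$, $$\lambda_{\min}\bigl(\mathbf{G}(\mathcal{X})\bigr)\ \ge\ C_8\Bigl(\frac{\Delta}{C_9}\Bigr)^{2(\ell-1)}.$$
   Context: For a set $\mathcal{X}=\{x_1,\dots,x_s\}\subset\mathbb{R}$ of $s$ pairwise distinct points, the generalized prolate matrix is $$\mathbf{G}(\mathcal{X})=\Bigl[\tfrac12\int_{-1}^{1}e^{\imath\omega(x_j-x_k)}\,d\omega\Bigr]_{j,k=1}^{s}\in\mathbb{R}^{s\times s},$$ which is symmetric positive definite; $\lambda_{\min}$ denotes its smallest eigenvalue. A set $\mathcal{X}=\{x_1,\dots,x_s\}\subset\mathbb{R}$ of $s$ distinct nodes forms a $(\Delta,\theta,s,\ell,\tau)_{\mathbb{R}}$-clustered configuration, for some $\Delta>0$, integers $1\le\ell\le s$, $\ell-1\le\tau$ and $\theta>0$, if for each $x_j$ there exist at most $\ell$ distinct nodes $\mathcal{X}^{(j)}=\{x_{j,k}\}_{k=1,\dots,r_j}\subset\mathcal{X}$, $1\le r_j\le\ell$, $x_{j,1}=x_j$, such that: (1) for any $y\in\mathcal{X}^{(j)}\setminus\{x_j\}$,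 $\Delta\le|y-x_j|\le\tau\Delta$; (2) for any $y\in\mathcal{X}\setminus\mathcal{X}^{(j)}$, $|y-x_j|\ge\theta$. *)

theory Defs
  imports "HOL-Analysis.Analysis" "Jordan_Normal_Form.Spectral_Radius"
begin

(* The integral below is real by symmetry (see prolate_kernel_of_real), so Re only changes its type. *)
definition prolate_kernel :: "real \<Rightarrow> real" where
  "prolate_kernel d = Re (1 / 2 * integral {-1..1} (\<lambda>w::real. exp (\<i> * of_real w * of_real d)))"

lemma prolate_kernel_of_real:
  "complex_of_real (prolate_kernel d) =
     1 / 2 * integral {-1..1} (\<lambda>w::real. exp (\<i> * of_real w * of_real d))"
proof -
  let ?f = "\<lambda>w::real. exp (\<i> * of_real w * of_real d)"
  have "cnj (integral {-1..1} ?f) = integral {-1..1} (\<lambda>w. cnj (?f w))"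
    by (rule integral_cnj)
  also have "(\<lambda>w. cnj (?f w)) = (\<lambda>w. ?f (- w))"
    by (auto simp: exp_cnj)
  also have "integral {-1..1} (\<lambda>w. ?f (- w)) = integral {-1..1} ?f"
    using Henstock_Kurzweil_Integration.integral_reflect_real[of "1::real" "-1" ?f] by simp
  finally have "integral {-1..1} ?f \<in> \<real>"
    by (simp add: Reals_cnj_iff)
  then obtain r where "integral {-1..1} ?f = of_real r"
    by (auto elim: Reals_cases)
  then show ?thesis
    by (simp add: prolate_kernel_def)
qed

(* The nodes are x 0, ..., x (s - 1). *)
definition prolate_matrix :: "nat \<Rightarrow> (nat \<Rightarrow> real) \<Rightarrow> real Matrix.mat" where
  "prolate_matrix s x = Matrix.mat s s (\<lambda>(j, k). prolate_kernel (x j - x k))"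

(* Meaningful for real symmetric matrices of positive dimension, whose real spectrum is
   finite and nonempty. *)
definition lambda_min :: "real Matrix.mat \<Rightarrow> real" where
  "lambda_min A = Min (spectrum A)"

(* In the existential, Y is the set of the nodes x_{j,k} attached to the node u = x_j. *)
definition clustered_configuration ::
  "real \<Rightarrow> real \<Rightarrow> nat \<Rightarrow> nat \<Rightarrow> real \<Rightarrow> real set \<Rightarrow> bool" where
  "clustered_configuration \<Delta> \<theta> s l \<tau> X \<longleftrightarrow>
     0 < \<Delta> \<and> 0 < \<theta> \<and> 1 \<le> l \<and> l \<le> s \<and> real l - 1 \<le> \<tau> \<and>
     finite X \<and> card X = s \<and>
     (\<forall>u\<in>X. \<exists>Y\<subseteq>X. u \<in> Y \<and> 1 \<le> card Y \<and> card Y \<le> l \<and>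
        (\<forall>y\<in>Y - {u}. \<Delta> \<le> \<bar>y - u\<bar> \<and> \<bar>y - u\<bar> \<le> \<tau> * \<Delta>) \<and>
        (\<forall>y\<in>X - Y. \<theta> \<le> \<bar>y - u\<bar>))"

end

theory Submission imports Defs
begin

text \<open>
  The quadratic form of the prolate matrix at \<open>v\<close> is half the energy \<open>\<integral> |f|\<^sup>2\<close> over \<open>{-1..1}\<close> of the
  exponential sum \<open>f w = (\<Sum>j. v j * cis (x j * w))\<close> (\<open>prolate_quadratic_form\<close>). So the claim is a lower
  bound for this energy in terms of the coefficients. The hypotheses split the nodes into clusters
  with at most \<open>l\<close> points, of diameter at most one and mutual distance at least \<open>\<theta>\<close>
  (\<open>clustered_configuration_partition\<close>), and \<open>f\<close> into the corresponding partial sums. Two facts are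
  needed.

  Different clusters are almost orthogonal (\<open>clusters_decouple\<close>). Up to a unimodular factor, the
  sum over a cluster is a sum of at most \<open>l\<close> exponentials with frequencies in \<open>{-1..1}\<close>. For such sums
  Bernstein's inequality bounds the derivative by a multiple of the supremum, and consequently the
  square mean bounds the supremum, with constants depending on \<open>l\<close> only (\<open>exponential_sum_bernstein\<close>,
  \<open>exponential_sum_sup_bound\<close>). Integration by parts against the fast relative phase of two
  clusters then makes their inner product at most a constant over \<open>\<theta>\<close> times the product of their
  norms. Because this error is relative, it does not matter that the energy of a cluster may be far
  below \<open>1 / \<theta>\<close>. With at most \<open>s\<close> clusters and \<open>\<theta>\<close> a large multiple of \<open>s\<close>, at least half of the
  sum of the energies of the clusters survives.

  Within one cluster each coefficient is bounded by the energy (\<open>cluster_energy_lower_bound\<close>).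
  The difference operator \<open>f \<mapsto> f (w + h) - cis (h * x j) * f w\<close> removes the node \<open>x j\<close>, at most doubles
  the norm, and multiplies the coefficient of another node \<open>x k\<close> by a number of modulus at least
  \<open>h * |x k - x j| / 2\<close>. Removing the \<open>n\<close> other nodes with \<open>h = 1 / n\<close> fits into half of the interval,
  and since the product of the distances from \<open>x k\<close> is at least \<open>(n * \<Delta> / (2 * exp 1)) ^ n\<close>, the
  total loss is \<open>(\<Delta> / (8 * exp 1)) ^ n\<close> in norm. The base is an absolute multiple of \<open>\<Delta>\<close>, and
  \<open>\<Delta> / (16 * pi * exp 1)\<close> leaves room to sum over the coefficients of the cluster.
\<close>

section \<open>Exponential sums and Bernstein's inequality\<close>

definition expsum :: "'a set \<Rightarrow> ('a \<Rightarrow> complex) \<Rightarrow> ('a \<Rightarrow> real) \<Rightarrow> real \<Rightarrow> complex" where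
  "expsum I c x w = (\<Sum>j\<in>I. c j * cis (x j * w))"

lemma expsum_has_vector_derivative [derivative_intros]:
  "(expsum I c x has_vector_derivative expsum I (\<lambda>j. \<i> * x j * c j) x w) (at w within A)"
proof -
  have "((\<lambda>w. c j * cis (x j * w)) has_vector_derivative \<i> * x j * c j * cis (x j * w))
          (at w within A)" for j
    unfolding has_vector_derivative_def
    by (auto intro!: derivative_eq_intros simp: scaleR_conv_of_real algebra_simps fun_eq_iff)
  then have "((\<lambda>w. \<Sum>j\<in>I. c j * cis (x j * w)) has_vector_derivative
               (\<Sum>j\<in>I. \<i> * x j * c j * cis (x j * w))) (at w within A)"
    by (intro has_vector_derivative_sum) auto
  then show ?thesis
    by (simp add: expsum_def [abs_def])
qed

lemma continuous_on_expsum [continuous_intros]: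
  "continuous_on A (expsum I c x)"
  using continuous_on_vector_derivative expsum_has_vector_derivative by blast

text \<open>
  Translating all frequencies only changes the phase, so a cluster may be moved to the origin
  without changing moduli. This is what turns a fast sum into a slow one.
\<close>

lemma expsum_modulate:
  "expsum I c (\<lambda>j. x j - y) w = cis (- (y * w)) * expsum I c x w"
  by (simp add: expsum_def sum_distrib_left cis_mult algebra_simps)

text \<open>
  A function whose derivative is at most \<open>K\<close> times its own size \<open>N\<close> needs length \<open>1 / (2 * K)\<close> to
  change by \<open>N / 2\<close>. Around a point where it has modulus \<open>N\<close> it is therefore large on an interval of
  fixed length. For \<open>K \<ge> 1/2\<close> such an interval fits into \<open>{-1..1}\<close> on at least one side of the point.
\<close>

lemma plateau:
  fixes v v' :: "real \<Rightarrow> complex"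
  assumes K: "K \<ge> 1/2"
    and der: "\<And>w. w \<in> {-1..1} \<Longrightarrow> (v has_vector_derivative v' w) (at w within {-1..1})"
    and bound: "\<And>w. w \<in> {-1..1} \<Longrightarrow> cmod (v' w) \<le> K * N"
    and w0: "w0 \<in> {-1..1}" and N: "N \<ge> 0"
  obtains a where "-1 \<le> a" "a + 1/(2*K) \<le> 1" "w0 \<in> {a..a + 1/(2*K)}"
    "\<And>t. t \<in> {a..a + 1/(2*K)} \<Longrightarrow> cmod (v t - v w0) \<le> N/2"
proof -
  define d where "d = 1/(2*K)"
  have d: "0 < d" "d \<le> 1" "d * (K * N) = N/2"
    using K by (auto simp: d_def field_simps)
  define a where "a = (if w0 \<le> 0 then w0 else w0 - d)"
  have a: "-1 \<le> a" "a + d \<le> 1" "a \<le> w0" "w0 \<le> a + d"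
    using w0 d by (auto simp: a_def)
  have "cmod (v t - v w0) \<le> N/2" if t: "t \<in> {a..a+d}" for t
  proof -
    have "norm (v t - v w0) \<le> (K * N) * norm (t - w0)"
    proof (rule differentiable_bound[where S = "{-1..1}"])
      fix w :: real assume w: "w \<in> {-1..1}"
      show "(v has_derivative (\<lambda>h. h *\<^sub>R v' w)) (at w within {-1..1})"
        using der[OF w] by (simp add: has_vector_derivative_def)
      show "onorm (\<lambda>h. h *\<^sub>R v' w) \<le> K * N"
        using bound[OF w] onorm_scaleR_left[of "\<lambda>h::real. h" "v' w"] bounded_linear_ident onorm_id
        by (simp add: onorm_id)
    qed (use a t w0 in auto)
    also have "\<dots> \<le> (K * N) * d"
      using t a d K N by (intro mult_left_mono) auto
    finally show ?thesis using d(3) by (simp add: mult.commute)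
  qed
  then show thesis using that a by (simp add: d_def)
qed

text \<open>
  If \<open>v = g'\<close> satisfies a Bernstein inequality, then \<open>v\<close> stays close to its maximum on an interval
  of length \<open>1 / (2 * K)\<close>, and over this interval \<open>g\<close> changes by a proportion of that maximum. Hence
  the maximum of \<open>v\<close> cannot be much larger than that of \<open>g\<close>: the Bernstein inequality passes from
  the derivative to the function.
\<close>

lemma derivative_le_of_plateau:
  fixes g v v' :: "real \<Rightarrow> complex"
  assumes K: "K \<ge> 1/2"
    and derg: "\<And>w. w \<in> {-1..1} \<Longrightarrow> (g has_vector_derivative v w) (at w within {-1..1})"
    and derv: "\<And>w. w \<in> {-1..1} \<Longrightarrow> (v has_vector_derivative v' w) (at w within {-1..1})"
    and v': "\<And>N w. (\<And>u. u \<in> {-1..1} \<Longrightarrow> cmod (v u) \<le> N) \<Longrightarrow> w \<in> {-1..1} \<Longrightarrow> cmod (v' w) \<le> K * N"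
    and g: "\<And>w. w \<in> {-1..1} \<Longrightarrow> cmod (g w) \<le> M"
    and w: "w \<in> {-1..1}"
  shows "cmod (v w) \<le> 8 * K * M"
proof -
  have "continuous_on {-1..1} v"
    using derv continuous_on_vector_derivative by blast
  then have "\<exists>w0\<in>{-1..1::real}. \<forall>u\<in>{-1..1}. cmod (v u) \<le> cmod (v w0)"
    by (intro continuous_attains_sup continuous_on_norm) auto
  then obtain w0 where w0: "w0 \<in> {-1..1}"
    and max: "\<And>u. u \<in> {-1..1} \<Longrightarrow> cmod (v u) \<le> cmod (v w0)" by blast
  define N where "N = cmod (v w0)"
  obtain a where a: "-1 \<le> a" "a + 1/(2*K) \<le> 1" "w0 \<in> {a..a + 1/(2*K)}"
    and near: "\<And>t. t \<in> {a..a + 1/(2*K)} \<Longrightarrow> cmod (v t - v w0) \<le> N/2"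
    using plateau[OF K derv, of N w0] v'[of N] max w0 by (auto simp: N_def)
  define d where "d = 1/(2*K)"
  have d: "d > 0" using K by (simp add: d_def)
  have sub: "{a..a+d} \<subseteq> {-1..1}" using a by (auto simp: d_def)
  have "norm (g (a+d) - g a - (a + d - a) *\<^sub>R v w0) \<le> norm (a + d - a) * (N/2)"
  proof (rule vector_differentiable_bound_linearization[where S = "{a..a+d}"])
    show "(g has_vector_derivative v x) (at x within {a..a+d})" if "x \<in> {a..a+d}" for x
      using derg[of x] sub that has_vector_derivative_within_subset by blast
  qed (use d near a in \<open>auto simp: closed_segment_eq_real_ivl d_def\<close>)
  then have "norm (d *\<^sub>R v w0 - (g (a+d) - g a)) \<le> d * (N/2)"
    using d by (simp add: norm_minus_commute)
  moreover have "norm (d *\<^sub>R v w0) - norm (g (a+d) - g a) \<le> norm (d *\<^sub>R v w0 - (g (a+d) - g a))"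
    by (rule norm_triangle_ineq2)
  moreover have "norm (g (a+d) - g a) \<le> 2 * M"
    using g[of "a+d"] g[of a] a norm_triangle_ineq4[of "g (a+d)" "g a"] sub d by auto
  ultimately have "d * N / 2 \<le> 2 * M"
    using d by (simp add: N_def)
  then have "N \<le> 8 * K * M"
    using K by (simp add: d_def field_simps)
  then show ?thesis using max[OF w] by (simp add: N_def)
qed

text \<open>
  Bernstein's inequality for exponential sums, with a constant that depends only on the number of
  terms and on the size of the frequencies, and not on their separation. Induction on the number of
  terms: after modulation by one of the frequencies, that term is constant, so the derivative has one
  term fewer. The induction hypothesis for this derivative gives the bound on the sum by
  \<open>derivative_le_of_plateau\<close>. Modulation can double the frequency bound, hence \<open>B\<close> is
  arbitrary in the induction.
\<close>

lemma exponential_sum_bernstein: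
  fixes B :: real
  shows "\<exists>K\<ge>0. \<forall>(I::'a set) c x M. finite I \<longrightarrow> card I \<le> m \<longrightarrow> (\<forall>j\<in>I. \<bar>x j\<bar> \<le> B) \<longrightarrow>
    (\<forall>w\<in>{-1..1}. cmod (expsum I c x w) \<le> M) \<longrightarrow>
    (\<forall>w\<in>{-1..1}. cmod (expsum I (\<lambda>j. \<i> * x j * c j) x w) \<le> K * M)"
proof (induction m arbitrary: B)
  case 0
  then show ?case by (intro exI[of _ 0]) (auto simp: expsum_def)
next
  case (Suc m)
  from Suc.IH[of "2*B"] obtain K0 where K0: "K0 \<ge> 0" and IH: 
    "\<And>(I::'a set) c x M w. finite I \<Longrightarrow> card I \<le> m \<Longrightarrow> (\<And>j. j\<in>I \<Longrightarrow> \<bar>x j\<bar> \<le> 2*B) \<Longrightarrow>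
    (\<And>w. w\<in>{-1..1} \<Longrightarrow> cmod (expsum I c x w) \<le> M) \<Longrightarrow> w\<in>{-1..1} \<Longrightarrow>
    cmod (expsum I (\<lambda>j. \<i> * x j * c j) x w) \<le> K0 * M"
    by (auto simp: Ball_def)
  define K where "K = max K0 (1/2)"
  show ?case
  proof (intro exI[of _ "\<bar>B\<bar> + 8*K"] conjI allI impI ballI)
    fix I :: "'a set" and c x M and w :: real
    assume I: "finite I" "card I \<le> Suc m" and B: "\<forall>j\<in>I. \<bar>x j\<bar> \<le> B"
      and M: "\<forall>w\<in>{-1..1}. cmod (expsum I c x w) \<le> M" and w: "w \<in> {-1..1}"
    have M0: "M \<ge> 0" using M w norm_ge_zero order_trans by blast
    show "cmod (expsum I (\<lambda>j. \<i> * x j * c j) x w) \<le> (\<bar>B\<bar> + 8*K) * M"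
    proof (cases "I = {}")
      case True
      then show ?thesis using M0 by (auto simp: expsum_def K_def)
    next
      case False
      then obtain j0 where j0: "j0 \<in> I" by blast
      define y where "y = (\<lambda>j. x j - x j0)"
      define v where "v = expsum I (\<lambda>j. \<i> * y j * c j) y"
      define v' where "v' = expsum I (\<lambda>j. \<i> * y j * (\<i> * y j * c j)) y"
      \<comment> \<open>The term at \<open>j0\<close> drops out of every derivative of the modulated sum.\<close>
      have red: "expsum I (\<lambda>j. complex_of_real (y j) * b j) y u = expsum (I - {j0}) (\<lambda>j. complex_of_real (y j) * b j) y u" for b u
        unfolding expsum_def using I by (intro sum.mono_neutral_right) (auto simp: y_def)
      have "cmod (v w) \<le> 8 * K * M"
      proof (rule derivative_le_of_plateau[where g = "expsum I c y" and v' = v'])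
        show "K \<ge> 1/2" by (simp add: K_def)
        fix u :: real assume u: "u \<in> {-1..1}"
        show "(expsum I c y has_vector_derivative v u) (at u within {-1..1})"
          unfolding v_def by (rule expsum_has_vector_derivative)
        show "(v has_vector_derivative v' u) (at u within {-1..1})"
          unfolding v_def v'_def by (rule expsum_has_vector_derivative)
        show "cmod (expsum I c y u) \<le> M"
          unfolding y_def using M u by (simp add: expsum_modulate norm_mult)
      next
        fix N u assume N: "\<And>u. u \<in> {-1..1} \<Longrightarrow> cmod (v u) \<le> N" and u: "u \<in> {-1..1::real}"
        have N0: "N \<ge> 0" using N[OF u] norm_ge_zero order_trans by blast
        have "cmod (expsum (I - {j0}) (\<lambda>j. \<i> * y j * (\<i> * y j * c j)) y u) \<le> K0 * N"
        proof (rule IH)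
          show "card (I - {j0}) \<le> m" using I j0 by simp
          show "\<bar>y j\<bar> \<le> 2 * B" if "j \<in> I - {j0}" for j
          proof -
            have "\<bar>x j\<bar> \<le> B" "\<bar>x j0\<bar> \<le> B" using B that j0 by auto
            then show ?thesis unfolding y_def by linarith
          qed
          show "cmod (expsum (I - {j0}) (\<lambda>j. \<i> * y j * c j) y w) \<le> N" if "w \<in> {-1..1}" for w
            using N[OF that] red[of "\<lambda>j. \<i> * c j"] by (simp add: v_def mult_ac)
        qed (use I u in auto)
        also have "expsum (I - {j0}) (\<lambda>j. \<i> * y j * (\<i> * y j * c j)) y u = v' u"
          using red[of "\<lambda>j. \<i> * (\<i> * y j * c j)" u] by (simp add: v'_def mult_ac)
        also have "K0 * N \<le> K * N"
          using N0 by (intro mult_right_mono) (auto simp: K_def)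
        finally show "cmod (v' u) \<le> K * N" .
      qed (use w in auto)
      moreover have "cis (x j0 * w) * v w = expsum I (\<lambda>j. \<i> * complex_of_real (x j - x j0) * c j) x w"
        unfolding v_def y_def expsum_modulate mult.assoc[symmetric] cis_mult by simp
      then have "expsum I (\<lambda>j. \<i> * x j * c j) x w = cis (x j0 * w) * v w + \<i> * x j0 * expsum I c x w"
        by (simp add: expsum_def sum_distrib_left algebra_simps sum_subtractf)
      then have "cmod (expsum I (\<lambda>j. \<i> * x j * c j) x w) \<le> cmod (v w) + \<bar>x j0\<bar> * cmod (expsum I c x w)"
        using norm_triangle_ineq[of "cis (x j0 * w) * v w" "\<i> * x j0 * expsum I c x w"]
        by (simp add: norm_mult)
      moreover have "\<bar>x j0\<bar> * cmod (expsum I c x w) \<le> \<bar>B\<bar> * M"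
        using B j0 M w M0 by (intro mult_mono) auto
      ultimately show ?thesis by (simp add: algebra_simps)
    qed
  qed (auto simp: K_def)
qed

section \<open>Energy\<close>

definition energy :: "(real \<Rightarrow> complex) \<Rightarrow> real" where
  "energy f = integral {-1..1} (\<lambda>w. (cmod (f w))\<^sup>2)"

lemma energy_nonneg: "energy f \<ge> 0"
  unfolding energy_def
  by (cases "(\<lambda>w. (cmod (f w))\<^sup>2) integrable_on {-1..1}")
     (auto intro: integral_nonneg simp: not_integrable_integral)

lemma energy_eq_inner:
  assumes "continuous_on {-1..1} f"
  shows "complex_of_real (energy f) = integral {-1..1} (\<lambda>w. f w * cnj (f w))"
proof -
  have "((\<lambda>w. (cmod (f w))\<^sup>2) has_integral energy f) {-1..1}"
    unfolding energy_def
    by (intro integrable_integral integrable_continuous_interval continuous_intros assms)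
  then have "((\<lambda>w. complex_of_real ((cmod (f w))\<^sup>2)) has_integral complex_of_real (energy f)) {-1..1}"
    by (rule has_integral_of_real)
  then show ?thesis
    by (simp add: complex_norm_square integral_unique del: of_real_power)
qed

text \<open>
  The square mean of a slow exponential sum controls its supremum, again because it is at least half
  of its maximum on an interval of fixed length. Bernstein's inequality extends this to the derivative.
  The constant does not see the separation of the frequencies, and this is why distinct clusters
  will decouple although the energy of a single cluster can be tiny.
\<close>

lemma exponential_sum_sup_bound:
  fixes B :: real
  shows "\<exists>K>0. \<forall>(I::'a set) c x. finite I \<longrightarrow> card I \<le> m \<longrightarrow> (\<forall>j\<in>I. \<bar>x j\<bar> \<le> B) \<longrightarrow>
    (\<forall>w\<in>{-1..1}. cmod (expsum I c x w) \<le> K * sqrt (energy (expsum I c x)) \<and>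
       cmod (expsum I (\<lambda>j. \<i> * x j * c j) x w) \<le> K * sqrt (energy (expsum I c x)))"
proof -
  obtain K0 where K0: "K0 \<ge> 0" and bern: 
    "\<And>(I::'a set) c x M w. finite I \<Longrightarrow> card I \<le> m \<Longrightarrow> (\<And>j. j\<in>I \<Longrightarrow> \<bar>x j\<bar> \<le> B) \<Longrightarrow>
    (\<And>w. w\<in>{-1..1} \<Longrightarrow> cmod (expsum I c x w) \<le> M) \<Longrightarrow> w\<in>{-1..1} \<Longrightarrow>
    cmod (expsum I (\<lambda>j. \<i> * x j * c j) x w) \<le> K0 * M"
    using exponential_sum_bernstein[of m B, where 'a = 'a] by (auto simp: Ball_def)
  define K where "K = max K0 (1/2)"
  have K: "K \<ge> 1/2" "K0 \<le> K" by (auto simp: K_def)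
  define L where "L = sqrt (8 * K)"
  show ?thesis
  proof (intro exI[of _ "(1 + K) * L"] conjI allI impI)
    show "0 < (1 + K) * L" using K by (simp add: L_def)
    fix I :: "'a set" and c x
    assume I: "finite I" "card I \<le> m" "\<forall>j\<in>I. \<bar>x j\<bar> \<le> B"
    define g where "g = expsum I c x"
    define g' where "g' = expsum I (\<lambda>j. \<i> * x j * c j) x"
    have cont: "continuous_on A g" for A unfolding g_def by (rule continuous_on_expsum)
    have der: "(g has_vector_derivative g' w) (at w within A)" for w A
      unfolding g_def g'_def by (rule expsum_has_vector_derivative)
    have "\<exists>w0\<in>{-1..1::real}. \<forall>u\<in>{-1..1}. cmod (g u) \<le> cmod (g w0)"
      by (intro continuous_attains_sup continuous_on_norm cont) auto
    then obtain w0 where w0: "w0 \<in> {-1..1}"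
      and max: "\<And>u. u \<in> {-1..1} \<Longrightarrow> cmod (g u) \<le> cmod (g w0)" by blast
    define N where "N = cmod (g w0)"
    have N0: "N \<ge> 0" by (simp add: N_def)
    have g': "cmod (g' w) \<le> K * N" if "w \<in> {-1..1}" for w
    proof -
      have "cmod (g' w) \<le> K0 * N"
        unfolding g'_def by (rule bern) (use I that max in \<open>auto simp: g_def N_def\<close>)
      also have "\<dots> \<le> K * N" using K N0 by (intro mult_right_mono)
      finally show ?thesis .
    qed
    obtain a where a: "-1 \<le> a" "a + 1/(2*K) \<le> 1"
      and near: "\<And>t. t \<in> {a..a + 1/(2*K)} \<Longrightarrow> cmod (g t - g w0) \<le> N/2"
      using plateau[OF K(1) der g' w0 N0] by blast
    define d where "d = 1/(2*K)"
    have d: "d > 0" using K by (simp add: d_def)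
    have sub: "{a..a+d} \<subseteq> {-1..1}" using a by (auto simp: d_def)
    have low: "(N/2)\<^sup>2 \<le> (cmod (g t))\<^sup>2" if "t \<in> {a..a+d}" for t
    proof -
      have "cmod (g w0) - cmod (g t) \<le> cmod (g t - g w0)"
        by (metis norm_minus_commute norm_triangle_ineq2)
      then have "N/2 \<le> cmod (g t)" using near[of t] that by (simp add: N_def d_def)
      then show ?thesis using N0 by (intro power_mono) auto
    qed
    have "d * (N/2)\<^sup>2 = integral {a..a+d} (\<lambda>_. (N/2)\<^sup>2)" using d by simp
    also have "\<dots> \<le> integral {a..a+d} (\<lambda>w. (cmod (g w))\<^sup>2)"
      by (intro integral_le integrable_continuous_interval continuous_intros cont low)
    also have "\<dots> \<le> energy g"
      unfolding energy_def
      by (intro integral_subset_le sub integrable_continuous_interval continuous_intros cont) auto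
    finally have "N\<^sup>2 \<le> 8 * K * energy g"
      using K by (simp add: d_def field_simps power2_eq_square)
    then have "N \<le> L * sqrt (energy g)"
      unfolding L_def by (metis N0 real_sqrt_le_mono real_sqrt_mult real_sqrt_unique)
    moreover from this have "K * N \<le> K * (L * sqrt (energy g))"
      using K by (intro mult_left_mono) auto
    moreover have "0 \<le> L * sqrt (energy g)" "0 \<le> K * (L * sqrt (energy g))"
      using K by (auto simp: L_def energy_nonneg)
    ultimately have "N \<le> (1 + K) * L * sqrt (energy g) \<and> K * N \<le> (1 + K) * L * sqrt (energy g)"
      by (simp add: algebra_simps)
    then show "\<forall>w\<in>{-1..1}. cmod (expsum I c x w) \<le> (1 + K) * L * sqrt (energy (expsum I c x)) \<and>
       cmod (expsum I (\<lambda>j. \<i> * x j * c j) x w) \<le> (1 + K) * L * sqrt (energy (expsum I c x))"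
      using max g' unfolding g_def[symmetric] g'_def[symmetric] N_def by (meson order_trans)
  qed
qed

section \<open>Decoupling of distant clusters\<close>

text \<open>
  Integrating the fast factor \<open>cis (Y * w)\<close> by parts gains a factor \<open>1 / \<bar>Y\<bar>\<close>.
\<close>

lemma oscillatory_integral_bound:
  fixes G G' :: "real \<Rightarrow> complex"
  assumes Y: "Y \<noteq> 0"
    and der: "\<And>w. w \<in> {-1..1} \<Longrightarrow> (G has_vector_derivative G' w) (at w within {-1..1})"
    and cont: "continuous_on {-1..1} G'"
    and P: "\<And>w. w \<in> {-1..1} \<Longrightarrow> cmod (G w) \<le> P"
    and Q: "\<And>w. w \<in> {-1..1} \<Longrightarrow> cmod (G' w) \<le> Q"
  shows "cmod (integral {-1..1} (\<lambda>w. cis (Y * w) * G w)) \<le> (2 * P + 2 * Q) / \<bar>Y\<bar>"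
proof -
  define F where "F w = cis (Y * w) * G w / (\<i> * Y)" for w
  have contG: "continuous_on {-1..1} G"
    using der continuous_on_vector_derivative by blast
  have derF: "(F has_vector_derivative cis (Y * w) * G w + cis (Y * w) * G' w / (\<i> * Y))
      (at w within {-1..1})" if "w \<in> {-1..1}" for w
  proof -
    have "((\<lambda>w. cis (Y * w)) has_vector_derivative \<i> * Y * cis (Y * w)) (at w within {-1..1})"
      unfolding has_vector_derivative_def
      by (auto intro!: derivative_eq_intros simp: scaleR_conv_of_real algebra_simps fun_eq_iff)
    from has_vector_derivative_mult[OF this der[OF that]]
    have "((\<lambda>w. cis (Y * w) * G w) has_vector_derivative
        cis (Y * w) * G' w + \<i> * Y * cis (Y * w) * G w) (at w within {-1..1})" .
    from has_vector_derivative_mult_right[OF this, of "1 / (\<i> * Y)"]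
    show ?thesis using Y unfolding F_def [abs_def] by (simp add: field_simps)
  qed
  have "((\<lambda>w. cis (Y * w) * G w + cis (Y * w) * G' w / (\<i> * Y)) has_integral (F 1 - F (-1))) {-1..1}"
    by (rule fundamental_theorem_of_calculus) (use derF in auto)
  moreover have int: "(\<lambda>w. cis (Y * w) * G' w / (\<i> * Y)) integrable_on {-1..1}"
    using Y by (intro integrable_continuous_interval continuous_intros cont) auto
  ultimately have eq: "integral {-1..1} (\<lambda>w. cis (Y * w) * G w)
      = F 1 - F (-1) - integral {-1..1} (\<lambda>w. cis (Y * w) * G' w / (\<i> * Y))"
    using has_integral_diff[OF _ integrable_integral[OF int]]
    by (intro integral_unique) fastforce
  have "cmod (integral {-1..1} (\<lambda>w. cis (Y * w) * G' w / (\<i> * Y))) \<le> Q / \<bar>Y\<bar> * (1 - (-1))"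
    by (intro integral_bound continuous_intros cont)
       (use Y Q in \<open>auto simp: norm_mult norm_divide divide_right_mono\<close>)
  moreover have "cmod (F 1) \<le> P / \<bar>Y\<bar>" "cmod (F (-1)) \<le> P / \<bar>Y\<bar>"
    using P[of 1] P[of "-1"] by (auto simp: F_def norm_mult norm_divide divide_right_mono)
  moreover have "cmod (F 1 - F (-1) - integral {-1..1} (\<lambda>w. cis (Y * w) * G' w / (\<i> * Y)))
      \<le> cmod (F 1) + cmod (F (-1)) + cmod (integral {-1..1} (\<lambda>w. cis (Y * w) * G' w / (\<i> * Y)))"
    by (meson add_right_mono norm_triangle_ineq4 order_trans)
  moreover have "(2 * P + 2 * Q) / \<bar>Y\<bar> = P / \<bar>Y\<bar> + P / \<bar>Y\<bar> + Q / \<bar>Y\<bar> * (1 - (-1))"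
    by (simp add: add_divide_distrib)
  ultimately show ?thesis unfolding eq by linarith
qed

text \<open>
  Small relative inner products perturb Pythagoras' theorem only by a factor. The loss is measured
  against the energies of the summands themselves, so it is harmless however small these are.
\<close>

lemma almost_orthogonal_energy:
  assumes P: "finite P" and e: "e \<ge> 0"
    and cont: "\<And>p. p \<in> P \<Longrightarrow> continuous_on {-1..1} (f p)"
    and orth: "\<And>p q. p \<in> P \<Longrightarrow> q \<in> P \<Longrightarrow> p \<noteq> q \<Longrightarrow>
      cmod (integral {-1..1} (\<lambda>w. f p w * cnj (f q w))) \<le> e * sqrt (energy (f p)) * sqrt (energy (f q))"
  shows "(1 - e * card P) * (\<Sum>p\<in>P. energy (f p)) \<le> energy (\<lambda>w. \<Sum>p\<in>P. f p w)"
proof -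
  define n where "n p = sqrt (energy (f p))" for p
  have n2: "(n p)\<^sup>2 = energy (f p)" for p by (simp add: n_def energy_nonneg)
  define A where "A p q = Re (integral {-1..1} (\<lambda>w. f p w * cnj (f q w)))" for p q
  have "complex_of_real (energy (\<lambda>w. \<Sum>p\<in>P. f p w))
      = integral {-1..1} (\<lambda>w. (\<Sum>p\<in>P. f p w) * cnj (\<Sum>q\<in>P. f q w))"
    by (intro energy_eq_inner continuous_intros cont)
  also have "\<dots> = integral {-1..1} (\<lambda>w. \<Sum>p\<in>P. \<Sum>q\<in>P. f p w * cnj (f q w))"
    by (simp add: sum_product)
  also have "\<dots> = (\<Sum>p\<in>P. integral {-1..1} (\<lambda>w. \<Sum>q\<in>P. f p w * cnj (f q w)))"
    by (intro integral_sum P integrable_continuous_interval continuous_intros cont)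
  also have "\<dots> = (\<Sum>p\<in>P. \<Sum>q\<in>P. integral {-1..1} (\<lambda>w. f p w * cnj (f q w)))"
    by (intro sum.cong refl integral_sum P integrable_continuous_interval continuous_intros cont)
  finally have eq: "energy (\<lambda>w. \<Sum>p\<in>P. f p w) = (\<Sum>p\<in>P. \<Sum>q\<in>P. A p q)"
    unfolding A_def by (metis (mono_tags, lifting) Re_complex_of_real Re_sum sum.cong)
  \<comment> \<open>Subtracting the error on the diagonal as well makes the errors add up to a square.\<close>
  have "(if p = q then energy (f p) else 0) - e * n p * n q \<le> A p q" if "p \<in> P" "q \<in> P" for p q
  proof (cases "p = q")
    case True
    have "A p p = energy (f p)"
      unfolding A_def using energy_eq_inner[OF cont, of p] that by (metis Re_complex_of_real)
    then show ?thesis using True e by (simp add: n_def energy_nonneg)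
  next
    case False
    then show ?thesis
      using orth[OF that False] abs_Re_le_cmod[of "integral {-1..1} (\<lambda>w. f p w * cnj (f q w))"]
      by (simp add: A_def n_def abs_le_iff)
  qed
  then have "(\<Sum>p\<in>P. \<Sum>q\<in>P. (if p = q then energy (f p) else 0) - e * n p * n q)
      \<le> energy (\<lambda>w. \<Sum>p\<in>P. f p w)"
    unfolding eq by (intro sum_mono) auto
  moreover have "e * (\<Sum>p\<in>P. n p)\<^sup>2 = (\<Sum>p\<in>P. \<Sum>q\<in>P. e * n p * n q)"
    unfolding power2_eq_square sum_product by (simp add: sum_distrib_left mult.assoc)
  then have "(\<Sum>p\<in>P. \<Sum>q\<in>P. (if p = q then energy (f p) else 0) - e * n p * n q)
      = (\<Sum>p\<in>P. energy (f p)) - e * (\<Sum>p\<in>P. n p)\<^sup>2"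
    using P by (simp add: sum_subtractf)
  ultimately have "(\<Sum>p\<in>P. energy (f p)) - e * (\<Sum>p\<in>P. n p)\<^sup>2 \<le> energy (\<lambda>w. \<Sum>p\<in>P. f p w)" by simp
  moreover have "e * (\<Sum>p\<in>P. n p)\<^sup>2 \<le> e * (card P * (\<Sum>p\<in>P. energy (f p)))"
    using sum_squared_le_sum_of_squares[of n P] e
    by (intro mult_left_mono) (auto simp: n2 mult.commute)
  ultimately show ?thesis by (simp add: algebra_simps)
qed

lemma energy_expsum_translate:
  "energy (expsum I c (\<lambda>j. x j - y)) = energy (expsum I c x)"
  by (simp add: energy_def expsum_modulate norm_mult)

text \<open>
  Centring each cluster at one of its nodes writes the product of the two sums as
  \<open>cis ((y1 - y2) * w)\<close> times a slow function, to which \<open>oscillatory_integral_bound\<close> applies.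
\<close>

lemma distant_clusters_inner:
  fixes K :: real
  assumes K: "K \<ge> 0"
    and bound: "\<And>S y w. S \<in> {S1, S2} \<Longrightarrow> y \<in> S \<Longrightarrow> w \<in> {-1..1} \<Longrightarrow>
        cmod (expsum S c (\<lambda>u. u - y) w) \<le> K * sqrt (energy (expsum S c (\<lambda>u. u)))"
    and bound': "\<And>S y w. S \<in> {S1, S2} \<Longrightarrow> y \<in> S \<Longrightarrow> w \<in> {-1..1} \<Longrightarrow>
        cmod (expsum S (\<lambda>u. \<i> * of_real (u - y) * c u) (\<lambda>u. u - y) w)
          \<le> K * sqrt (energy (expsum S c (\<lambda>u. u)))"
    and y: "y1 \<in> S1" "y2 \<in> S2" "\<theta> \<le> \<bar>y1 - y2\<bar>" "\<theta> > 0"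
  shows "cmod (integral {-1..1} (\<lambda>w. expsum S1 c (\<lambda>u. u) w * cnj (expsum S2 c (\<lambda>u. u) w)))
    \<le> 6 * K\<^sup>2 / \<theta> * sqrt (energy (expsum S1 c (\<lambda>u. u))) * sqrt (energy (expsum S2 c (\<lambda>u. u)))"
proof -
  define n1 n2 where "n1 = sqrt (energy (expsum S1 c (\<lambda>u. u)))"
    and "n2 = sqrt (energy (expsum S2 c (\<lambda>u. u)))"
  have n: "n1 \<ge> 0" "n2 \<ge> 0" by (auto simp: n1_def n2_def energy_nonneg)
  define g1 g2 where "g1 = expsum S1 c (\<lambda>u. u - y1)" and "g2 = expsum S2 c (\<lambda>u. u - y2)"
  define d1 d2 where "d1 = expsum S1 (\<lambda>u. \<i> * of_real (u - y1) * c u) (\<lambda>u. u - y1)"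
    and "d2 = expsum S2 (\<lambda>u. \<i> * of_real (u - y2) * c u) (\<lambda>u. u - y2)"
  have le: "cmod (g1 w) \<le> K * n1" "cmod (g2 w) \<le> K * n2" "cmod (d1 w) \<le> K * n1" "cmod (d2 w) \<le> K * n2"
    if "w \<in> {-1..1}" for w
    using bound[of S1 y1 w] bound[of S2 y2 w] bound'[of S1 y1 w] bound'[of S2 y2 w] y that
    by (auto simp: g1_def g2_def d1_def d2_def n1_def n2_def)
  have cont: "continuous_on A g1" "continuous_on A g2" "continuous_on A d1" "continuous_on A d2" for A
    unfolding g1_def g2_def d1_def d2_def by (rule continuous_on_expsum)+
  have prodle: "cmod (a * cnj b) \<le> K\<^sup>2 * n1 * n2" if "cmod a \<le> K * n1" "cmod b \<le> K * n2" for a b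
    using mult_mono[OF that] K n by (simp add: norm_mult power2_eq_square mult_ac)
  have "cmod (integral {-1..1} (\<lambda>w. cis ((y1 - y2) * w) * (g1 w * cnj (g2 w))))
    \<le> (2 * (K\<^sup>2 * n1 * n2) + 2 * (2 * (K\<^sup>2 * n1 * n2))) / \<bar>y1 - y2\<bar>"
  proof (rule oscillatory_integral_bound)
    show "y1 - y2 \<noteq> 0" using y by auto
    show "continuous_on {-1..1} (\<lambda>w. g1 w * cnj (d2 w) + d1 w * cnj (g2 w))"
      by (intro continuous_intros cont)
    fix w :: real assume w: "w \<in> {-1..1}"
    have "((\<lambda>w. cnj (g2 w)) has_vector_derivative cnj (d2 w)) (at w within {-1..1})"
      unfolding g2_def d2_def by (intro has_vector_derivative_cnj expsum_has_vector_derivative)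
    moreover have "(g1 has_vector_derivative d1 w) (at w within {-1..1})"
      unfolding g1_def d1_def by (rule expsum_has_vector_derivative)
    ultimately show "((\<lambda>w. g1 w * cnj (g2 w)) has_vector_derivative g1 w * cnj (d2 w) + d1 w * cnj (g2 w))
        (at w within {-1..1})"
      using has_vector_derivative_mult by blast
    show "cmod (g1 w * cnj (g2 w)) \<le> K\<^sup>2 * n1 * n2"
      by (intro prodle le w)
    have "cmod (g1 w * cnj (d2 w) + d1 w * cnj (g2 w)) \<le> K\<^sup>2 * n1 * n2 + K\<^sup>2 * n1 * n2"
      by (rule order_trans[OF norm_triangle_ineq add_mono]) (intro prodle le w)+
    then show "cmod (g1 w * cnj (d2 w) + d1 w * cnj (g2 w)) \<le> 2 * (K\<^sup>2 * n1 * n2)" by linarith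
  qed
  also have "\<dots> = 6 * K\<^sup>2 * n1 * n2 / \<bar>y1 - y2\<bar>" by simp
  also have "\<dots> \<le> 6 * K\<^sup>2 * n1 * n2 / \<theta>"
    using y n by (intro divide_left_mono) auto
  also have "(\<lambda>w. cis ((y1 - y2) * w) * (g1 w * cnj (g2 w)))
      = (\<lambda>w. expsum S1 c (\<lambda>u. u) w * cnj (expsum S2 c (\<lambda>u. u) w))"
  proof
    fix w
    have "cis ((y1 - y2) * w) * (cis (- (y1 * w)) * cis (y2 * w)) = 1"
      by (simp add: cis_mult algebra_simps)
    moreover have "cis ((y1 - y2) * w) * (g1 w * cnj (g2 w)) = cis ((y1 - y2) * w) * (cis (- (y1 * w)) * cis (y2 * w))
        * (expsum S1 c (\<lambda>u. u) w * cnj (expsum S2 c (\<lambda>u. u) w))"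
      unfolding g1_def g2_def expsum_modulate by (simp add: cis_cnj)
    ultimately show "cis ((y1 - y2) * w) * (g1 w * cnj (g2 w))
      = expsum S1 c (\<lambda>u. u) w * cnj (expsum S2 c (\<lambda>u. u) w)" by simp
  qed
  finally show ?thesis by (simp add: n1_def n2_def)
qed

text \<open>
  The diameter bound by one is what makes the sums of the centred clusters slow, with Bernstein
  constants that depend only on \<open>l\<close>.
\<close>

definition separated_clusters :: "nat \<Rightarrow> real \<Rightarrow> real set set \<Rightarrow> bool" where
  "separated_clusters l \<theta> P \<longleftrightarrow> finite P \<and> disjoint P \<and>
     (\<forall>S\<in>P. finite S \<and> S \<noteq> {} \<and> card S \<le> l \<and> (\<forall>u\<in>S. \<forall>v\<in>S. \<bar>u - v\<bar> \<le> 1)) \<and>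
     (\<forall>S\<in>P. \<forall>T\<in>P. S \<noteq> T \<longrightarrow> (\<forall>u\<in>S. \<forall>v\<in>T. \<theta> \<le> \<bar>u - v\<bar>))"

text \<open>
  By \<open>distant_clusters_inner\<close> the relative inner products of distinct clusters are at most
  \<open>6 * K\<^sup>2 / \<theta>\<close>. Therefore a gap of \<open>12 * K\<^sup>2\<close> times the number of clusters
  limits the loss in \<open>almost_orthogonal_energy\<close> to one half.
\<close>

lemma clusters_decouple:
  "\<exists>C>0. \<forall>P \<theta> c. separated_clusters l \<theta> P \<longrightarrow> 0 < \<theta> \<longrightarrow> C * real (card P) \<le> \<theta> \<longrightarrow>
     (\<Sum>S\<in>P. energy (expsum S c (\<lambda>u. u))) / 2 \<le> energy (expsum (\<Union>P) c (\<lambda>u. u))"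
proof -
  obtain K where K: "K > 0" and sup_all:
    "\<forall>(S :: real set) c x. finite S \<longrightarrow> card S \<le> l \<longrightarrow> (\<forall>j\<in>S. \<bar>x j\<bar> \<le> 1) \<longrightarrow>
      (\<forall>w\<in>{-1..1}. cmod (expsum S c x w) \<le> K * sqrt (energy (expsum S c x)) \<and>
        cmod (expsum S (\<lambda>j. \<i> * x j * c j) x w) \<le> K * sqrt (energy (expsum S c x)))"
    using exponential_sum_sup_bound[of l 1, where 'a = real] by (elim exE conjE)
  show ?thesis
  proof (intro exI[of _ "12 * K\<^sup>2"] conjI allI impI)
    show "0 < 12 * K\<^sup>2" using K by simp
    fix P :: "real set set" and \<theta> c
    assume "separated_clusters l \<theta> P"
    then have P: "finite P" "disjoint P"
      and S: "\<forall>S\<in>P. finite S \<and> S \<noteq> {} \<and> card S \<le> l \<and> (\<forall>u\<in>S. \<forall>v\<in>S. \<bar>u - v\<bar> \<le> 1)"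
      and far: "\<forall>S\<in>P. \<forall>T\<in>P. S \<noteq> T \<longrightarrow> (\<forall>u\<in>S. \<forall>v\<in>T. \<theta> \<le> \<bar>u - v\<bar>)"
      unfolding separated_clusters_def by - (elim conjE, assumption)+
    assume \<theta>: "0 < \<theta>" "12 * K\<^sup>2 * real (card P) \<le> \<theta>"
    define f where "f S = expsum S c (\<lambda>u::real. u)" for S
    define e where "e = 6 * K\<^sup>2 / \<theta>"
    have e: "e \<ge> 0" "e * card P \<le> 1/2" using \<theta> by (auto simp: e_def field_simps)
    have orth: "cmod (integral {-1..1} (\<lambda>w. f S w * cnj (f T w))) \<le> e * sqrt (energy (f S)) * sqrt (energy (f T))"
      if ST: "S \<in> P" "T \<in> P" "S \<noteq> T" for S T
    proof -
      obtain y1 y2 where y: "y1 \<in> S" "y2 \<in> T" using S ST by blast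
      have sup': "cmod (expsum R c (\<lambda>u. u - y) w) \<le> K * sqrt (energy (expsum R c (\<lambda>u. u))) \<and>
          cmod (expsum R (\<lambda>u. \<i> * of_real (u - y) * c u) (\<lambda>u. u - y) w)
            \<le> K * sqrt (energy (expsum R c (\<lambda>u. u)))"
        if "R \<in> {S, T}" "y \<in> R" "w \<in> {-1..1}" for R y w
      proof -
        have "\<bar>u - y\<bar> \<le> 1" if "u \<in> R" for u using S ST that \<open>R \<in> {S, T}\<close> \<open>y \<in> R\<close> by blast
        moreover have "finite R" "card R \<le> l" using S ST that by auto
        ultimately show ?thesis
          using sup_all[rule_format, of R "\<lambda>u. u - y" w c] \<open>w \<in> {-1..1}\<close>
          by (simp add: energy_expsum_translate)
      qed
      show ?thesis unfolding f_def e_def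
        by (rule distant_clusters_inner[of K S T c y1 y2 \<theta>])
           (use K sup' y far ST \<theta> in auto)
    qed
    have "(1 - e * card P) * (\<Sum>S\<in>P. energy (f S)) \<le> energy (\<lambda>w. \<Sum>S\<in>P. f S w)"
      by (rule almost_orthogonal_energy[OF P(1) e(1) _ orth]) (simp_all add: f_def continuous_on_expsum)
    moreover have "1/2 * (\<Sum>S\<in>P. energy (f S)) \<le> (1 - e * card P) * (\<Sum>S\<in>P. energy (f S))"
      using e by (intro mult_right_mono sum_nonneg energy_nonneg) auto
    moreover have "(\<lambda>w. \<Sum>S\<in>P. f S w) = expsum (\<Union>P) c (\<lambda>u. u)"
      unfolding f_def expsum_def using P S by (subst sum.Union_disjoint) (auto simp: disjoint_def)
    ultimately show "(\<Sum>S\<in>P. energy (expsum S c (\<lambda>u. u))) / 2 \<le> energy (expsum (\<Union>P) c (\<lambda>u. u))"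
      by (simp add: f_def)
  qed
qed

section \<open>The energy of a single cluster\<close>

text \<open>
  With \<open>z = cis (h * x k)\<close> the difference operator annihilates the frequency \<open>x k\<close>.
\<close>

lemma expsum_shift_diff:
  "expsum I (\<lambda>j. c j * (cis (h * x j) - z)) x w = expsum I c x (w + h) - z * expsum I c x w"
  by (simp add: expsum_def sum_subtractf sum_distrib_left algebra_simps flip: cis_mult)

text \<open>
  Each of the difference operators \<open>f \<mapsto> f (w + h) - cis (h * x k) * f w\<close> at most doubles the \<open>L\<^sup>2\<close> norm and
  shortens the interval on which the result is controlled by \<open>h\<close>.
\<close>

lemma node_elimination_energy:
  fixes a b h :: real
  assumes J: "finite J" and h: "h \<ge> 0"
  shows "integral {a..b - card J * h}
      (\<lambda>w. (cmod (expsum I (\<lambda>j. c j * (\<Prod>i\<in>J. cis (h * x j) - cis (h * x i))) x w))\<^sup>2)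
    \<le> 4 ^ card J * integral {a..b} (\<lambda>w. (cmod (expsum I c x w))\<^sup>2)"
  using J
proof (induction J)
  case empty
  then show ?case by simp
next
  case (insert k J)
  define d where "d = (\<lambda>j. c j * (\<Prod>i\<in>J. cis (h * x j) - cis (h * x i)))"
  define F where "F = expsum I d x"
  have cont: "continuous_on A F" for A unfolding F_def by (rule continuous_on_expsum)
  have int: "(\<lambda>w. (cmod (F w))\<^sup>2) integrable_on {a..b}" for a b
    by (intro integrable_continuous_interval continuous_intros cont)
  have cont_shift: "continuous_on A (\<lambda>w. F (w + h))" for A
    by (rule continuous_on_compose2[OF cont[of UNIV]]) (auto intro: continuous_intros)
  define e where "e = b - card J * h"
  have step: "expsum I (\<lambda>j. c j * (\<Prod>i\<in>insert k J. cis (h * x j) - cis (h * x i))) x w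
      = F (w + h) - cis (h * x k) * F w" for w
    using insert by (simp add: F_def d_def flip: expsum_shift_diff) (simp add: mult_ac)
  have sq: "(cmod (u - cis t * v))\<^sup>2 \<le> 2 * (cmod u)\<^sup>2 + 2 * (cmod v)\<^sup>2" for u v t
  proof -
    have "cmod (u - cis t * v) \<le> cmod u + cmod v"
      using norm_triangle_ineq4[of u "cis t * v"] by (simp add: norm_mult)
    then have "(cmod (u - cis t * v))\<^sup>2 \<le> (cmod u + cmod v)\<^sup>2" by (intro power_mono) auto
    also have "\<dots> \<le> 2 * (cmod u)\<^sup>2 + 2 * (cmod v)\<^sup>2"
      using sum_squares_bound[of "cmod u" "cmod v"] by (simp add: power2_sum)
    finally show ?thesis .
  qed
  have "integral {a..e - h} (\<lambda>w. (cmod (F (w + h) - cis (h * x k) * F w))\<^sup>2)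
      \<le> integral {a..e - h} (\<lambda>w. 2 * (cmod (F (w + h)))\<^sup>2 + 2 * (cmod (F w))\<^sup>2)"
    by (intro integral_le integrable_continuous_interval continuous_intros cont cont_shift sq)
  also have "\<dots> = 2 * integral {a..e - h} (\<lambda>w. (cmod (F (w + h)))\<^sup>2)
      + 2 * integral {a..e - h} (\<lambda>w. (cmod (F w))\<^sup>2)"
    by (subst integral_add)
       (auto intro!: integrable_continuous_interval continuous_intros cont cont_shift)
  also have "integral {a..e - h} (\<lambda>w. (cmod (F (w + h)))\<^sup>2) = integral {a+h..e} (\<lambda>w. (cmod (F w))\<^sup>2)"
    using integral_shift_Icc_real[of a "e - h" "\<lambda>w. (cmod (F w))\<^sup>2" h] by (simp add: o_def add.commute)
  also have "\<dots> \<le> integral {a..e} (\<lambda>w. (cmod (F w))\<^sup>2)"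
    using h by (intro integral_subset_le int) auto
  also have "integral {a..e - h} (\<lambda>w. (cmod (F w))\<^sup>2) \<le> integral {a..e} (\<lambda>w. (cmod (F w))\<^sup>2)"
    using h by (intro integral_subset_le int) auto
  also have "integral {a..e} (\<lambda>w. (cmod (F w))\<^sup>2)
      \<le> 4 ^ card J * integral {a..b} (\<lambda>w. (cmod (expsum I c x w))\<^sup>2)"
    using insert.IH by (simp add: e_def F_def d_def)
  finally show ?case
    unfolding step using insert(1,2) by (simp add: e_def algebra_simps)
qed

text \<open>
  Eliminating all frequencies but \<open>x k\<close> leaves a single exponential, whose modulus is constant. The
  bound on \<open>h\<close> keeps an interval of length at least one.
\<close>

lemma coefficient_le_energy:
  assumes I: "finite I" "k \<in> I" and h: "h \<ge> 0" "real (card I - 1) * h \<le> 1"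
  shows "(cmod (c k))\<^sup>2 * (\<Prod>i\<in>I-{k}. cmod (cis (h * x k) - cis (h * x i)))\<^sup>2
    \<le> 4 ^ (card I - 1) * energy (expsum I c x)"
proof -
  define d where "d = (\<lambda>j. c j * (\<Prod>i\<in>I-{k}. cis (h * x j) - cis (h * x i)))"
  define D where "D = cmod (d k)"
  have "d j = 0" if "j \<in> I" "j \<noteq> k" for j
    using that I by (auto simp: d_def)
  then have "expsum I d x w = (\<Sum>j\<in>{k}. d j * cis (x j * w))" for w
    unfolding expsum_def using I by (intro sum.mono_neutral_right) auto
  then have eq: "cmod (expsum I d x w) = D" for w
    by (simp add: norm_mult D_def)
  have card: "card (I - {k}) = card I - 1" using I by simp
  have "D\<^sup>2 * 1 \<le> D\<^sup>2 * (2 - real (card I - 1) * h)"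
    using h by (intro mult_left_mono) auto
  also have "\<dots> = integral {-1..1 - real (card I - 1) * h} (\<lambda>w. (cmod (expsum I d x w))\<^sup>2)"
    using h by (simp add: eq)
  also have "\<dots> \<le> 4 ^ (card I - 1) * energy (expsum I c x)"
    using node_elimination_energy[of "I - {k}" h "-1" 1 I c x] I h
    by (simp add: d_def energy_def card)
  finally show ?thesis
    by (simp add: D_def d_def norm_mult power_mult_distrib flip: prod_norm)
qed

lemma cis_diff_ge:
  assumes "\<bar>a - b\<bar> \<le> 1"
  shows "\<bar>a - b\<bar> / 2 \<le> cmod (cis a - cis b)"
proof -
  define t where "t = (a - b) / 2"
  have t: "\<bar>t\<bar> \<le> 1" using assms by (simp add: t_def)
  have "cis a - cis b = cis b * (cis (a - b) - 1)"
    by (simp add: algebra_simps cis_mult)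
  then have "cmod (cis a - cis b) = cmod (exp (\<i> * of_real (a - b)) - 1)"
    by (simp add: norm_mult cis_conv_exp del: of_real_diff)
  also have "\<dots> = 2 * \<bar>sin t\<bar>" unfolding t_def by (rule dist_exp_i_1)
  finally have *: "cmod (cis a - cis b) = 2 * \<bar>sin t\<bar>" .
  have "\<bar>sin t - t\<bar> \<le> \<bar>t\<bar> ^ 3 / 6"
    using Maclaurin_sin_bound[of t 3] by (simp add: numeral_3_eq_3 sin_coeff_def lessThan_Suc fact_numeral)
  also have "\<bar>t\<bar> ^ 3 \<le> \<bar>t\<bar> ^ 1" by (rule power_decreasing) (use t in auto)
  finally have "\<bar>t\<bar> / 2 \<le> \<bar>sin t\<bar>" by (simp add: field_simps abs_if split: if_splits)
  then show ?thesis by (simp add: * t_def)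
qed

text \<open>
  The term of index \<open>n\<close> in the series of \<open>exp n\<close> is at most the sum.
\<close>

lemma power_le_exp_fact: "real n ^ n \<le> exp 1 ^ n * fact n"
proof -
  have s: "summable (\<lambda>k. real n ^ k /\<^sub>R fact k)" by (rule summable_exp_generic)
  have "(\<Sum>k\<in>{n}. real n ^ k /\<^sub>R fact k) \<le> (\<Sum>k. real n ^ k /\<^sub>R fact k)"
    by (rule sum_le_suminf[OF s]) auto
  then have "real n ^ n / fact n \<le> exp (real n)"
    by (simp add: exp_def divide_inverse mult.commute)
  also have "\<dots> = exp 1 ^ n" by (simp flip: exp_of_nat_mult)
  finally show ?thesis by (simp add: field_simps)
qed

text \<open>
  On one side of \<open>u\<close> the distances, in increasing order, are at least \<open>D\<close>, \<open>2 * D\<close>, \<open>3 * D\<close>, and so on.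
\<close>

lemma prod_distances_one_side:
  fixes T :: "real set"
  assumes D: "D \<ge> 0" and T: "finite T" and gt: "\<And>v. v \<in> T \<Longrightarrow> u < v"
    and sep: "\<And>v w. v \<in> insert u T \<Longrightarrow> w \<in> insert u T \<Longrightarrow> v \<noteq> w \<Longrightarrow> D \<le> \<bar>v - w\<bar>"
  shows "D ^ card T * fact (card T) \<le> (\<Prod>v\<in>T. \<bar>v - u\<bar>)"
proof -
  \<comment> \<open>The induction on the largest element has to carry along that some element is far from \<open>u\<close>.\<close>
  have "(\<exists>v\<in>insert u T. card T * D \<le> v - u) \<and> D ^ card T * fact (card T) \<le> (\<Prod>v\<in>T. \<bar>v - u\<bar>)"
    using T gt sep
  proof (induction T rule: finite_linorder_max_induct)
    case empty
    then show ?case by simp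
  next
    case (insert b A)
    have b: "b \<notin> A" using insert.hyps by auto
    obtain v where v: "v \<in> insert u A" "card A * D \<le> v - u"
      and IH: "D ^ card A * fact (card A) \<le> (\<Prod>v\<in>A. \<bar>v - u\<bar>)"
      using insert by (metis insertCI insertE)
    have "v < b" using v insert by auto
    then have "D \<le> b - v" using insert.prems(2)[of v b] v by auto
    then have far: "card (insert b A) * D \<le> b - u"
      using v b insert.hyps by (simp add: algebra_simps)
    have "D ^ card (insert b A) * fact (card (insert b A))
        = (card (insert b A) * D) * (D ^ card A * fact (card A))"
      using b insert.hyps by simp
    also have "\<dots> \<le> \<bar>b - u\<bar> * (\<Prod>v\<in>A. \<bar>v - u\<bar>)"
      using far IH D by (intro mult_mono) auto
    also have "\<dots> = (\<Prod>v\<in>insert b A. \<bar>v - u\<bar>)"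
      using b insert.hyps by simp
    finally show ?case using far by blast
  qed
  then show ?thesis ..
qed

text \<open>
  With \<open>p\<close> points to the right of \<open>u\<close> and \<open>q\<close> to the left, the product is at least \<open>D ^ (p + q)\<close> times
  \<open>fact p * fact q\<close>, and the latter is at least \<open>fact (p + q) / 2 ^ (p + q)\<close>, since binomial
  coefficients are at most powers of two.
\<close>

lemma prod_distances_ge:
  fixes S :: "real set"
  assumes D: "D \<ge> 0" and S: "finite S" "u \<in> S"
    and sep: "\<And>v w. v \<in> S \<Longrightarrow> w \<in> S \<Longrightarrow> v \<noteq> w \<Longrightarrow> D \<le> \<bar>v - w\<bar>"
    and n: "n = card S - 1"
  shows "(D * n / (2 * exp 1)) ^ n \<le> (\<Prod>v\<in>S-{u}. \<bar>v - u\<bar>)"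
proof -
  define R where "R = {v\<in>S. u < v}"
  define L where "L = {v\<in>S. v < u}"
  define p q where "p = card R" and "q = card L"
  have RL: "finite R" "finite L" "R \<inter> L = {}" "S - {u} = R \<union> L"
    using S by (auto simp: R_def L_def)
  have npq: "n = p + q"
    using RL S card_Un_disjoint[of R L] by (simp add: n p_def q_def flip: RL(4))
  have "D ^ p * fact p \<le> (\<Prod>v\<in>R. \<bar>v - u\<bar>)"
    unfolding p_def by (rule prod_distances_one_side) (use D RL S sep in \<open>auto simp: R_def\<close>)
  moreover have "D ^ q * fact q \<le> (\<Prod>v\<in>L. \<bar>v - u\<bar>)"
  proof -
    have "D ^ card (uminus ` L) * fact (card (uminus ` L)) \<le> (\<Prod>v\<in>uminus ` L. \<bar>v - - u\<bar>)"
    proof (rule prod_distances_one_side)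
      fix v w assume "v \<in> insert (- u) (uminus ` L)" "w \<in> insert (- u) (uminus ` L)" "v \<noteq> w"
      then have "- v \<in> S" "- w \<in> S" "- v \<noteq> - w" using S by (auto simp: L_def)
      then have "D \<le> \<bar>- v - - w\<bar>" by (rule sep)
      then show "D \<le> \<bar>v - w\<bar>" by simp
    qed (use D RL in \<open>auto simp: L_def\<close>)
    then show ?thesis
      by (simp add: q_def card_image inj_on_def prod.reindex abs_minus_commute)
  qed
  ultimately have prod: "(D ^ p * fact p) * (D ^ q * fact q) \<le> (\<Prod>v\<in>S-{u}. \<bar>v - u\<bar>)"
    unfolding RL(4) using RL D by (subst prod.union_disjoint) (auto intro!: mult_mono prod_nonneg)
  have "fact n = fact p * fact q * real (n choose p)"
    using binomial_fact_lemma[of p n] by (metis add_diff_cancel_left' le_add1 npq of_nat_fact of_nat_mult)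
  also have "\<dots> \<le> fact p * fact q * 2 ^ n"
    using binomial_le_pow2[of n p] by (intro mult_left_mono) (auto simp flip: of_nat_le_iff)
  finally have "real n ^ n \<le> exp 1 ^ n * (fact p * fact q * 2 ^ n)"
    using power_le_exp_fact[of n] by (meson exp_ge_zero mult_left_mono order_trans zero_le_power)
  then have "(n / (2 * exp 1)) ^ n \<le> fact p * fact q"
    by (simp add: power_divide power_mult_distrib field_simps)
  then have "D ^ n * (n / (2 * exp 1)) ^ n \<le> D ^ n * (fact p * fact q)"
    using D by (intro mult_left_mono) auto
  then show ?thesis using prod by (simp add: npq power_add power_divide power_mult_distrib mult_ac)
qed

text \<open>
  The bound for one cluster. With \<open>n\<close> nodes to eliminate, the step is \<open>h = 1 / n\<close>, and the growth
  \<open>n ^ n\<close> of the product of distances compensates \<open>h ^ n\<close>. This makes the loss per eliminated node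
  an absolute constant, \<open>D / (8 * exp 1)\<close>: a factor \<open>D / (2 * exp 1)\<close> from the distances, \<open>1/2\<close> from
  the chord, and \<open>1/2\<close> from the norm of the difference operator. Reducing it further to
  \<open>D / (16 * exp 1)\<close> gains \<open>4 ^ n\<close>, which absorbs the number \<open>n + 1\<close> of coefficients.
\<close>

lemma cluster_energy_lower_bound:
  fixes S :: "real set"
  assumes D: "D \<ge> 0" and S: "finite S" "S \<noteq> {}"
    and sep: "\<And>v w. v \<in> S \<Longrightarrow> w \<in> S \<Longrightarrow> v \<noteq> w \<Longrightarrow> D \<le> \<bar>v - w\<bar>"
    and diam: "\<And>v w. v \<in> S \<Longrightarrow> w \<in> S \<Longrightarrow> \<bar>v - w\<bar> \<le> 1"
  shows "(D / (16 * pi * exp 1)) ^ (2 * (card S - 1)) * (\<Sum>u\<in>S. (cmod (c u))\<^sup>2)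
    \<le> energy (expsum S c (\<lambda>u. u))"
proof -
  define n where "n = card S - 1"
  have card: "card S = n + 1" using S by (simp add: n_def card_gt_0_iff Suc_leI)
  define E where "E = energy (expsum S c (\<lambda>u. u))"
  have pow: "(2 * y) ^ (2 * n) = 4 ^ n * y ^ (2 * n)" for y :: real
    by (simp add: power_mult power_mult_distrib)
  have one: "(cmod (c u))\<^sup>2 * (D / (8 * exp 1)) ^ (2 * n) \<le> E" if u: "u \<in> S" for u
  proof -
    define h where "h = 1 / real n"
    have h: "h \<ge> 0" "n * h \<le> 1" "h \<le> 1" by (auto simp: h_def divide_simps)
    have "(D / (4 * exp 1)) ^ n = (h / 2) ^ n * (D * n / (2 * exp 1)) ^ n"
    proof (cases "n = 0")
      case False
      then have "D / (4 * exp 1) = h / 2 * (D * n / (2 * exp 1))" by (simp add: h_def)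
      then show ?thesis by (metis power_mult_distrib)
    qed simp
    also have "\<dots> \<le> (h / 2) ^ n * (\<Prod>v\<in>S-{u}. \<bar>v - u\<bar>)"
      using prod_distances_ge[OF D S(1) u sep] h by (intro mult_left_mono) (auto simp: n_def)
    also have "\<dots> = (\<Prod>v\<in>S-{u}. \<bar>h * u - h * v\<bar> / 2)"
      using S u h by (simp add: n_def abs_mult abs_minus_commute prod.distrib prod_dividef power_divide
          flip: right_diff_distrib)
    also have "\<dots> \<le> (\<Prod>v\<in>S-{u}. cmod (cis (h * u) - cis (h * v)))"
    proof (intro prod_mono conjI cis_diff_ge)
      fix v assume "v \<in> S - {u}"
      then have "h * \<bar>u - v\<bar> \<le> 1 * 1" using diam u h by (intro mult_mono) auto
      then show "\<bar>h * u - h * v\<bar> \<le> 1" using h by (simp add: abs_mult flip: right_diff_distrib)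
    qed auto
    finally have "((D / (4 * exp 1)) ^ n)\<^sup>2 \<le> (\<Prod>v\<in>S-{u}. cmod (cis (h * u) - cis (h * v)))\<^sup>2"
      using D by (intro power_mono) auto
    then have "(cmod (c u))\<^sup>2 * ((D / (4 * exp 1)) ^ n)\<^sup>2 \<le> 4 ^ n * E"
      using coefficient_le_energy[OF S(1) u, of h c "\<lambda>u. u"] h
      by (fold n_def E_def) (meson mult_left_mono order_trans zero_le_power2)
    moreover have "((D / (4 * exp 1)) ^ n)\<^sup>2 = 4 ^ n * (D / (8 * exp 1)) ^ (2 * n)"
      using pow[of "D / (8 * exp 1)"] by (simp add: power_even_eq)
    ultimately show ?thesis by simp
  qed
  have "(D / (16 * pi * exp 1)) ^ (2 * n) \<le> (D / (16 * exp 1)) ^ (2 * n)"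
    using D pi_ge_two by (intro power_mono divide_left_mono) auto
  also have "\<dots> = (D / (8 * exp 1)) ^ (2 * n) / 4 ^ n"
    using pow[of "D / (16 * exp 1)"] by simp
  finally have "(D / (16 * pi * exp 1)) ^ (2 * n) * (\<Sum>u\<in>S. (cmod (c u))\<^sup>2)
      \<le> (D / (8 * exp 1)) ^ (2 * n) / 4 ^ n * (\<Sum>u\<in>S. (cmod (c u))\<^sup>2)"
    by (intro mult_right_mono sum_nonneg) auto
  also have "\<dots> = (\<Sum>u\<in>S. (cmod (c u))\<^sup>2 * (D / (8 * exp 1)) ^ (2 * n)) / 4 ^ n"
    by (simp add: sum_distrib_right mult.commute)
  also have "\<dots> \<le> (\<Sum>u\<in>S. E) / 4 ^ n"
    by (intro divide_right_mono sum_mono one) auto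
  also have "\<dots> = (n + 1) / 4 ^ n * E" by (simp add: card)
  also have "\<dots> \<le> 1 * E"
  proof (intro mult_right_mono)
    have "n + 1 \<le> 4 ^ n" by (induction n) auto
    then have "real (n + 1) \<le> 4 ^ n" by (metis of_nat_le_iff of_nat_numeral of_nat_power)
    then show "(n + 1) / 4 ^ n \<le> (1::real)" by simp
  qed (simp add: E_def energy_nonneg)
  finally show ?thesis by (simp add: n_def E_def)
qed

section \<open>The prolate matrix and its smallest eigenvalue\<close>

text \<open>
  The minimum of the spectrum means something only if the spectrum over the reals is nonempty. A
  complex eigenvalue exists, the quadratic form of its eigenvector shows that it is real, and it is a
  root of the real characteristic polynomial.
\<close>

lemma symmetric_real_spectrum_nonempty:
  fixes A :: "real Matrix.mat"
  assumes A: "A \<in> carrier_mat n n" and n: "n > 0"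
    and sym: "\<And>j k. j < n \<Longrightarrow> k < n \<Longrightarrow> A $$ (j,k) = A $$ (k,j)"
  shows "spectrum A \<noteq> {}"
proof -
  define M :: "complex Matrix.mat" where "M = map_mat of_real A"
  have M: "M \<in> carrier_mat n n" using A by (simp add: M_def)
  obtain \<mu> where \<mu>: "eigenvalue M \<mu>"
    using spectrum_non_empty[OF M] n by (auto simp: spectrum_def)
  then obtain z where z: "z \<in> carrier_vec n" "z \<noteq> 0\<^sub>v n" "M *\<^sub>v z = \<mu> \<cdot>\<^sub>v z"
    using M by (auto simp: eigenvalue_def eigenvector_def)
  have row: "(\<Sum>k<n. of_real (A $$ (j,k)) * (vec_index z k)) = \<mu> * (vec_index z j)" if "j < n" for j
  proof -
    have "vec_index (M *\<^sub>v z) j = \<mu> * (vec_index z j)" using z that by simp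
    then show ?thesis
      using that z M A by (simp add: scalar_prod_def M_def atLeast0LessThan)
  qed
  define q where "q = (\<Sum>j<n. \<Sum>k<n. cnj (vec_index z j) * of_real (A $$ (j,k)) * (vec_index z k))"
  define r where "r = (\<Sum>j<n. (cmod (vec_index z j))\<^sup>2)"
  have "q = (\<Sum>j<n. cnj (vec_index z j) * (\<Sum>k<n. of_real (A $$ (j,k)) * (vec_index z k)))"
    by (simp add: q_def sum_distrib_left mult.assoc)
  also have "\<dots> = (\<Sum>j<n. cnj (vec_index z j) * (\<mu> * (vec_index z j)))"
    by (intro sum.cong refl) (simp add: row)
  also have "\<dots> = \<mu> * of_real r"
    by (simp add: r_def sum_distrib_left complex_norm_square mult_ac del: of_real_power)
  finally have q: "q = \<mu> * of_real r" .
  have "cnj q = (\<Sum>j<n. \<Sum>k<n. cnj (vec_index z k) * of_real (A $$ (k,j)) * (vec_index z j))"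
    unfolding q_def by (auto simp: sym mult_ac intro!: sum.cong)
  also have "\<dots> = q" unfolding q_def by (rule sum.swap)
  finally have "cnj \<mu> * of_real r = \<mu> * of_real r" using q by simp
  moreover have "r \<noteq> 0"
  proof
    assume "r = 0"
    then have "(vec_index z j) = 0" if "j < n" for j
      using that sum_nonneg_eq_0_iff[of "{..<n}" "\<lambda>j. (cmod (vec_index z j))\<^sup>2"] by (auto simp: r_def)
    then have "z = 0\<^sub>v n" using z by (intro eq_vecI) auto
    then show False using z by simp
  qed
  ultimately have "cnj \<mu> = \<mu>" by simp
  then obtain m where m: "\<mu> = of_real m" by (metis Reals_cnj_iff Reals_cases)
  have "poly (char_poly M) \<mu> = 0" using \<mu> eigenvalue_root_char_poly[OF M] by simp
  then have "poly (char_poly A) m = 0"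
    unfolding M_def of_real_hom.char_poly_hom[OF A] m by simp
  then show ?thesis using spectrum_root_char_poly[OF A] by auto
qed

lemma prolate_kernel_integral:
  "complex_of_real (2 * prolate_kernel d) = integral {-1..1} (\<lambda>w. cis (d * w))"
proof -
  have "(\<lambda>w. exp (\<i> * of_real w * of_real d)) = (\<lambda>w. cis (d * w))"
    by (simp add: cis_conv_exp mult_ac fun_eq_iff)
  then show ?thesis using prolate_kernel_of_real[of d] by (simp add: mult.commute)
qed

lemma prolate_kernel_minus: "prolate_kernel (- d) = prolate_kernel d"
proof -
  have "complex_of_real (2 * prolate_kernel (- d)) = complex_of_real (2 * prolate_kernel d)"
    using Henstock_Kurzweil_Integration.integral_reflect_real[of 1 "-1" "\<lambda>w. cis (d * w)"]
    unfolding prolate_kernel_integral by simp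
  then show ?thesis unfolding of_real_eq_iff by simp
qed

text \<open>
  The prolate matrix is half the Gram matrix of the exponentials in \<open>L\<^sup>2\<close> of \<open>{-1..1}\<close>.
\<close>

lemma prolate_quadratic_form:
  fixes v x :: "nat \<Rightarrow> real"
  shows "(\<Sum>j<s. \<Sum>k<s. v j * v k * prolate_kernel (x j - x k))
    = energy (expsum {..<s} (\<lambda>j. of_real (v j)) x) / 2"
proof -
  let ?f = "expsum {..<s} (\<lambda>j. of_real (v j)) x"
  have "complex_of_real (energy ?f) = integral {-1..1} (\<lambda>w. ?f w * cnj (?f w))"
    by (intro energy_eq_inner continuous_on_expsum)
  also have "(\<lambda>w. ?f w * cnj (?f w)) = (\<lambda>w. \<Sum>j<s. \<Sum>k<s. of_real (v j * v k) * cis ((x j - x k) * w))"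
    by (simp add: expsum_def sum_product cis_cnj cis_mult algebra_simps fun_eq_iff
        flip: cis_divide)
  also have "integral {-1..1} \<dots> = (\<Sum>j<s. \<Sum>k<s. of_real (v j * v k) * integral {-1..1} (\<lambda>w. cis ((x j - x k) * w)))"
  proof -
    have summand: "((\<lambda>w. of_real (v j * v k) * cis ((x j - x k) * w)) has_integral
        of_real (v j * v k) * integral {-1..1} (\<lambda>w. cis ((x j - x k) * w))) {-1..1}" for j k
      by (intro has_integral_mult_right integrable_integral integrable_continuous_interval
          continuous_intros)
    show ?thesis
      by (intro integral_unique has_integral_sum summand) auto
  qed
  also have "\<dots> = complex_of_real (\<Sum>j<s. \<Sum>k<s. v j * v k * (2 * prolate_kernel (x j - x k)))"
    by (simp flip: prolate_kernel_integral)
  finally have "energy ?f = (\<Sum>j<s. \<Sum>k<s. v j * v k * (2 * prolate_kernel (x j - x k)))"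
    unfolding of_real_eq_iff .
  then show ?thesis by (simp add: sum_divide_distrib mult.assoc)
qed

lemma lambda_min_prolate_ge:
  assumes s: "s > 0"
    and bound: "\<And>v. \<kappa> * (\<Sum>j<s. (v j)\<^sup>2) \<le> energy (expsum {..<s} (\<lambda>j. of_real (v j)) x) / 2"
  shows "\<kappa> \<le> lambda_min (prolate_matrix s x)"
proof -
  define A where "A = prolate_matrix s x"
  have A: "A \<in> carrier_mat s s" by (simp add: A_def prolate_matrix_def)
  have entry: "A $$ (j,k) = prolate_kernel (x j - x k)" if "j < s" "k < s" for j k
    using that by (simp add: A_def prolate_matrix_def)
  have "spectrum A \<noteq> {}"
  proof (rule symmetric_real_spectrum_nonempty[OF A s])
    fix j k assume "j < s" "k < s"
    then show "A $$ (j,k) = A $$ (k,j)"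
      using prolate_kernel_minus[of "x j - x k"] by (simp add: entry)
  qed
  then have "Min (spectrum A) \<in> spectrum A"
    using card_finite_spectrum(1)[OF A] by (intro Min_in)
  then have "eigenvalue A (lambda_min A)"
    by (simp add: lambda_min_def spectrum_def)
  then obtain v where v: "v \<in> carrier_vec s" "v \<noteq> 0\<^sub>v s" "A *\<^sub>v v = lambda_min A \<cdot>\<^sub>v v"
    using A by (auto simp: eigenvalue_def eigenvector_def)
  define r where "r = (\<Sum>j<s. (vec_index v j)\<^sup>2)"
  have row: "(\<Sum>k<s. A $$ (j,k) * (vec_index v k)) = lambda_min A * (vec_index v j)" if "j < s" for j
  proof -
    have "vec_index (A *\<^sub>v v) j = (\<Sum>k<s. A $$ (j,k) * vec_index v k)"
      using that v(1) A by (simp add: scalar_prod_def atLeast0LessThan)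
    then show ?thesis using v that by simp
  qed
  have "\<kappa> * r \<le> energy (expsum {..<s} (\<lambda>j. of_real (vec_index v j)) x) / 2"
    unfolding r_def by (rule bound)
  also have "\<dots> = (\<Sum>j<s. \<Sum>k<s. (vec_index v j) * (vec_index v k) * prolate_kernel (x j - x k))"
    by (rule prolate_quadratic_form[symmetric])
  also have "\<dots> = (\<Sum>j<s. (vec_index v j) * (\<Sum>k<s. A $$ (j,k) * (vec_index v k)))"
    by (simp add: sum_distrib_left entry mult_ac)
  also have "\<dots> = (\<Sum>j<s. (vec_index v j) * (lambda_min A * (vec_index v j)))"
    by (intro sum.cong refl) (simp add: row)
  also have "\<dots> = lambda_min A * r"
    by (simp add: r_def sum_distrib_left power2_eq_square mult_ac)
  finally have "\<kappa> * r \<le> lambda_min A * r" .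
  moreover have "r > 0"
  proof -
    have "\<exists>j<s. (vec_index v j) \<noteq> 0"
    proof (rule ccontr)
      assume "\<not> (\<exists>j<s. (vec_index v j) \<noteq> 0)"
      then have "v = 0\<^sub>v s" using v by (intro eq_vecI) auto
      then show False using v by simp
    qed
    then show ?thesis unfolding r_def by (auto intro!: sum_pos2)
  qed
  ultimately show ?thesis by (simp add: A_def)
qed

section \<open>Clustered configurations\<close>

text \<open>
  The neighbourhoods of the nodes are given separately for each node. As all distances are either at
  most \<open>\<tau> * \<Delta> \<le> 1\<close> or at least \<open>\<theta> > 2\<close>, the given neighbourhood of \<open>u\<close> must consist of
  the nodes within \<open>\<tau> * \<Delta>\<close> of \<open>u\<close>, and being that close is a transitive relation. Its classes
  are the clusters.
\<close>

lemma clustered_configuration_partition: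
  assumes conf: "clustered_configuration \<Delta> \<theta> s l \<tau> X"
    and small: "\<tau> * \<Delta> \<le> 1" and large: "2 < \<theta>"
  shows "\<exists>P. separated_clusters l \<theta> P \<and> \<Union>P = X \<and> card P \<le> s \<and>
    (\<forall>S\<in>P. \<forall>u\<in>S. \<forall>v\<in>S. u \<noteq> v \<longrightarrow> \<Delta> \<le> \<bar>u - v\<bar>)"
proof -
  have basic: "0 < \<Delta>" "1 \<le> l" "real l - 1 \<le> \<tau>" "finite X" "card X = s"
    using conf by (auto simp: clustered_configuration_def)
  have rho: "0 \<le> \<tau> * \<Delta>" using basic by simp
  have gap: "2 * (\<tau> * \<Delta>) < \<theta>" using small large by linarith
  define N where "N u = {v\<in>X. \<bar>v - u\<bar> \<le> \<tau> * \<Delta>}" for u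
  have nbhd: "card (N u) \<le> l" "\<And>v. v \<in> X \<Longrightarrow> v \<notin> N u \<Longrightarrow> \<theta> \<le> \<bar>v - u\<bar>"
    "\<And>v. v \<in> N u \<Longrightarrow> v \<noteq> u \<Longrightarrow> \<Delta> \<le> \<bar>v - u\<bar>" if u: "u \<in> X" for u
  proof -
    obtain Y where Y: "Y \<subseteq> X" "u \<in> Y" "card Y \<le> l"
      "\<And>y. y \<in> Y - {u} \<Longrightarrow> \<Delta> \<le> \<bar>y - u\<bar> \<and> \<bar>y - u\<bar> \<le> \<tau> * \<Delta>"
      "\<And>y. y \<in> X - Y \<Longrightarrow> \<theta> \<le> \<bar>y - u\<bar>"
      using conf u unfolding clustered_configuration_def by meson
    have "N u = Y"
    proof
      show "N u \<subseteq> Y" using Y(5) gap rho by (force simp: N_def)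
      show "Y \<subseteq> N u" using Y(1,4) rho by (force simp: N_def)
    qed
    then show "card (N u) \<le> l" "\<And>v. v \<in> X \<Longrightarrow> v \<notin> N u \<Longrightarrow> \<theta> \<le> \<bar>v - u\<bar>"
      "\<And>v. v \<in> N u \<Longrightarrow> v \<noteq> u \<Longrightarrow> \<Delta> \<le> \<bar>v - u\<bar>"
      using Y by auto
  qed
  have NX: "N u \<subseteq> X" for u by (auto simp: N_def)
  have self: "u \<in> N u" if "u \<in> X" for u using that rho by (simp add: N_def)
  have trans: "w \<in> N u" if "u \<in> X" "v \<in> N u" "w \<in> N v" for u v w
  proof (rule ccontr)
    assume "w \<notin> N u"
    then have "\<theta> \<le> \<bar>w - u\<bar>" using nbhd(2)[OF that(1)] NX that by blast
    moreover have "\<bar>w - v\<bar> \<le> \<tau> * \<Delta>" "\<bar>v - u\<bar> \<le> \<tau> * \<Delta>" using that by (auto simp: N_def)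
    ultimately show False using gap by linarith
  qed
  have sym: "u \<in> N v" if "u \<in> X" "v \<in> N u" for u v
    using that by (auto simp: N_def abs_minus_commute)
  have same: "N v = N u" if "u \<in> X" "v \<in> N u" for u v
    using trans sym that NX by blast
  have cluster: "finite S \<and> S \<noteq> {} \<and> card S \<le> l \<and> (\<forall>u\<in>S. \<forall>v\<in>S. \<bar>u - v\<bar> \<le> 1)"
    "\<forall>u\<in>S. \<forall>v\<in>S. u \<noteq> v \<longrightarrow> \<Delta> \<le> \<bar>u - v\<bar>"
    if S: "S \<in> N ` X" for S
  proof -
    obtain w where w: "w \<in> X" "S = N w" using S by blast
    have pair: "\<bar>u - v\<bar> \<le> 1 \<and> (u \<noteq> v \<longrightarrow> \<Delta> \<le> \<bar>u - v\<bar>)" if "u \<in> S" "v \<in> S" for u v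
    proof -
      have v: "v \<in> X" using that(2) w NX by blast
      have "u \<in> N v" using same[of w v] that w by simp
      then show ?thesis using nbhd(3)[OF v] small by (auto simp: N_def)
    qed
    then have "\<forall>u\<in>S. \<forall>v\<in>S. \<bar>u - v\<bar> \<le> 1" by blast
    moreover have "finite S" using w NX basic finite_subset by blast
    moreover have "S \<noteq> {}" using self w by blast
    ultimately show "finite S \<and> S \<noteq> {} \<and> card S \<le> l \<and> (\<forall>u\<in>S. \<forall>v\<in>S. \<bar>u - v\<bar> \<le> 1)"
      using nbhd(1) w by simp
    show "\<forall>u\<in>S. \<forall>v\<in>S. u \<noteq> v \<longrightarrow> \<Delta> \<le> \<bar>u - v\<bar>" using pair by blast
  qed
  have gaps: "\<theta> \<le> \<bar>u - v\<bar>" if ST: "S \<in> N ` X" "T \<in> N ` X" "S \<noteq> T" and "u \<in> S" "v \<in> T" for S T u v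
  proof -
    obtain a b where ab: "a \<in> X" "S = N a" "b \<in> X" "T = N b" using ST by blast
    then have uv: "u \<in> X" "v \<in> X" "N u = S" "N v = T" using that same NX by blast+
    then have "u \<notin> N v" using same[of v u] ST by auto
    then show ?thesis using nbhd(2) uv by blast
  qed
  have disj: "disjoint (N ` X)"
    unfolding disjoint_def using same by (metis (no_types, opaque_lifting) disjoint_iff imageE)
  have fin: "finite (N ` X)" using basic by simp
  have "separated_clusters l \<theta> (N ` X)"
    unfolding separated_clusters_def
    by (intro conjI fin disj ballI impI) (use cluster(1) gaps in blast)+
  moreover have "\<Union> (N ` X) = X" using NX self by blast
  moreover have "card (N ` X) \<le> s" using basic card_image_le by blast
  ultimately show ?thesis
    using cluster(2) by blast
qed

theorem theorem2p3:
  "\<exists>(C8::real) (C10::nat \<Rightarrow> real) (C11::nat \<Rightarrow> real).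
     0 < C8 \<and> (\<forall>l\<ge>1. 0 < C10 l \<and> 0 < C11 l) \<and>
     (\<forall>(s::nat) (l::nat) (\<Delta>::real) (\<theta>::real) (\<tau>::real) (x::nat \<Rightarrow> real).
        inj_on x {..<s} \<longrightarrow>
        clustered_configuration \<Delta> \<theta> s l \<tau> (x ` {..<s}) \<longrightarrow>
        C10 l * real s \<le> \<theta> \<longrightarrow>
        real s * \<tau> * \<Delta> \<le> C11 l \<longrightarrow>
        lambda_min (prolate_matrix s x) \<ge> C8 * (\<Delta> / (16 * pi * exp 1)) ^ (2 * (l - 1)))"
proof -
  obtain C :: "nat \<Rightarrow> real" where Cpos: "\<And>l. C l > 0"
    and decouple: "\<And>l P \<theta> c. separated_clusters l \<theta> P \<Longrightarrow> 0 < \<theta> \<Longrightarrow> C l * real (card P) \<le> \<theta> \<Longrightarrow>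
     (\<Sum>S\<in>P. energy (expsum S c (\<lambda>u. u))) / 2 \<le> energy (expsum (\<Union>P) c (\<lambda>u. u))"
    using clusters_decouple by metis
  show ?thesis
  proof (rule exI[of _ "1/4"], rule exI[of _ "\<lambda>l. C l + 3"], rule exI[of _ "\<lambda>l. 1"], intro conjI allI impI)
    \<comment> \<open>The constant \<open>1/4\<close> is \<open>1/2\<close> from the Gram matrix times \<open>1/2\<close> from the decoupling; the
      added \<open>3\<close> forces \<open>\<theta> > 2\<close>.\<close>
    show "0 < C l + 3" for l using Cpos[of l] by linarith
    fix s l :: nat and \<Delta> \<theta> \<tau> :: real and x :: "nat \<Rightarrow> real"
    assume inj: "inj_on x {..<s}"
      and conf: "clustered_configuration \<Delta> \<theta> s l \<tau> (x ` {..<s})"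
      and \<theta>: "(C l + 3) * real s \<le> \<theta>" and small: "real s * \<tau> * \<Delta> \<le> 1"
    define \<delta> where "\<delta> = \<Delta> / (16 * pi * exp 1)"
    have basic: "0 < \<Delta>" "0 < \<theta>" "1 \<le> l" "l \<le> s" "real l - 1 \<le> \<tau>"
      using conf by (auto simp: clustered_configuration_def)
    have s1: "real s \<ge> 1" using basic by simp
    have tau: "0 \<le> \<tau> * \<Delta>" using basic by simp
    have "1 * (\<tau> * \<Delta>) \<le> real s * (\<tau> * \<Delta>)" by (intro mult_right_mono s1 tau)
    then have diam: "\<tau> * \<Delta> \<le> 1" using small by (simp add: mult.assoc)
    have "3 * 1 \<le> (C l + 3) * real s" by (intro mult_mono) (use s1 Cpos[of l] in auto)
    then have large: "2 < \<theta>" using \<theta> by linarith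
    have \<delta>0: "0 \<le> \<delta>" using basic by (simp add: \<delta>_def)
    have \<delta>1: "\<delta> \<le> 1" if "l \<noteq> 1"
    proof -
      have "1 * \<Delta> \<le> \<tau> * \<Delta>" using that basic by (intro mult_right_mono) auto
      then have "\<Delta> \<le> 1" using diam by linarith
      moreover have "1 * 1 * 1 \<le> 16 * pi * exp 1"
        using pi_ge_two by (intro mult_mono) (auto simp: one_le_exp_iff)
      ultimately show ?thesis by (simp add: \<delta>_def divide_le_eq)
    qed
    obtain P where clusters: "separated_clusters l \<theta> P" and P: "\<Union>P = x ` {..<s}" "card P \<le> s"
      and sep: "\<forall>S\<in>P. \<forall>u\<in>S. \<forall>v\<in>S. u \<noteq> v \<longrightarrow> \<Delta> \<le> \<bar>u - v\<bar>"
      using clustered_configuration_partition[OF conf diam large] by blast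
    have disj: "disjoint P" using clusters by (simp add: separated_clusters_def)
    have PS: "finite S" "S \<noteq> {}" "card S \<le> l" "\<forall>u\<in>S. \<forall>v\<in>S. \<bar>u - v\<bar> \<le> 1" if "S \<in> P" for S
      using clusters that unfolding separated_clusters_def by blast+
    have CP: "C l * card P \<le> \<theta>"
    proof -
      have "C l * card P \<le> (C l + 3) * s" using P(2) Cpos[of l] by (intro mult_mono) auto
      then show ?thesis using \<theta> by linarith
    qed
    show "1/4 * (\<Delta> / (16 * pi * exp 1)) ^ (2 * (l - 1)) \<le> lambda_min (prolate_matrix s x)"
      unfolding \<delta>_def[symmetric]
    proof (rule lambda_min_prolate_ge)
      show "s > 0" using basic by simp
      fix v :: "nat \<Rightarrow> real"
      define c :: "real \<Rightarrow> complex" where "c u = of_real (v (the_inv_into {..<s} x u))" for u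
      have cx: "c (x j) = of_real (v j)" if "j < s" for j
        using that inj by (simp add: c_def the_inv_into_f_f)
      have reindex: "expsum (x ` {..<s}) c (\<lambda>u. u) = expsum {..<s} (\<lambda>j. of_real (v j)) x"
        by (auto simp: expsum_def sum.reindex[OF inj] cx fun_eq_iff)
      have "\<delta> ^ (2 * (l - 1)) * (\<Sum>j<s. (v j)\<^sup>2) = \<delta> ^ (2 * (l - 1)) * (\<Sum>u\<in>x ` {..<s}. (cmod (c u))\<^sup>2)"
        by (simp add: sum.reindex[OF inj] cx)
      also have "\<dots> = (\<Sum>S\<in>P. \<delta> ^ (2 * (l - 1)) * (\<Sum>u\<in>S. (cmod (c u))\<^sup>2))"
        unfolding P(1)[symmetric] using disj PS(1)
        by (subst sum.Union_disjoint) (auto simp: disjoint_def sum_distrib_left)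
      also have "\<dots> \<le> (\<Sum>S\<in>P. energy (expsum S c (\<lambda>u. u)))"
      proof (rule sum_mono)
        fix S assume S: "S \<in> P"
        \<comment> \<open>For \<open>l = 1\<close> nothing bounds \<open>\<Delta>\<close>, but then both exponents vanish.\<close>
        have "\<delta> ^ (2 * (l - 1)) \<le> \<delta> ^ (2 * (card S - 1))"
          using \<delta>0 \<delta>1 PS[OF S] by (cases "l = 1") (auto intro!: power_decreasing diff_le_mono)
        then have "\<delta> ^ (2 * (l - 1)) * (\<Sum>u\<in>S. (cmod (c u))\<^sup>2)
            \<le> \<delta> ^ (2 * (card S - 1)) * (\<Sum>u\<in>S. (cmod (c u))\<^sup>2)"
          by (intro mult_right_mono sum_nonneg) auto
        also have "\<dots> \<le> energy (expsum S c (\<lambda>u. u))"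
          unfolding \<delta>_def
          by (rule cluster_energy_lower_bound) (use PS[OF S] basic sep S in auto)
        finally show "\<delta> ^ (2 * (l - 1)) * (\<Sum>u\<in>S. (cmod (c u))\<^sup>2) \<le> energy (expsum S c (\<lambda>u. u))" .
      qed
      finally have "\<delta> ^ (2 * (l - 1)) * (\<Sum>j<s. (v j)\<^sup>2) \<le> (\<Sum>S\<in>P. energy (expsum S c (\<lambda>u. u)))" .
      moreover have "(\<Sum>S\<in>P. energy (expsum S c (\<lambda>u. u))) / 2 \<le> energy (expsum (\<Union>P) c (\<lambda>u. u))"
        by (rule decouple[OF clusters basic(2) CP])
      ultimately show "1/4 * \<delta> ^ (2 * (l - 1)) * (\<Sum>j<s. (v j)\<^sup>2) \<le> energy (expsum {..<s} (\<lambda>j. of_real (v j)) x) / 2"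
        unfolding P(1) reindex by (simp add: mult.commute)
    qed
  qed auto
qed

end
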